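(* For every two integers $k,n\ge 1$ and for every field $\mathbb{F}$, the graph $K_{k,m}$ is $(n,k)$-subspace choosable over $\mathbb{F}$ for $m = \sum_{i=0}^{k-1}\big\lfloor \frac{n-1}{k-i} \big\rfloor$.
   Context: Inner product: on $\mathbb{C}^t$, $\langle x,y\rangle=\sum_i x_i\overline{y_i}$; on $\mathbb{F}^t$ for every other field $\mathbb{F}$ (in particular $\mathbb{R}$ and finite fields), $\langle x,y\rangle=\sum_i x_iy_i$. For a finite simple graph $G=(V,E)$ and a function $f$ from $V$ to the positive integers, $G$ is $f$-subspace choosable over a field $\mathbb{F}$ if for every integer $t$ and every assignment of subspaces $W_v\subseteq\mathbb{F}^t$ with $\dim(W_v)=f(v)$ to the vertices $v\in V$, there exists a choice of a nonzero vector $x_v\in W_v$ for each $v\in V$ such that $\langle x_v,x_{v'}\rangle=0$ whenever $v$ and $v'$ are adjacent in $G$. The complete bipartite graph $K_{\ell_1,\ell_2}$, with vertex set $A$ of size $\ell_1$ on the left side and vertex set $B$ of size $\ell_2$ on the right side, is $(k_1,k_2)$-subspace choosable over $\mathbb{F}$ if it is $f$-subspace choosable over $\mathbb{F}$ for the function $f$ with $f(u)=k_1$ for every $u\in A$ and $f(u)=k_2$ for every $u\in B$. *)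

theory Defs
  imports "Jordan_Normal_Form.VS_Connect" "Graph_Theory.Graph_Theory"
begin

definition subspace_of_dim :: "nat \<Rightarrow> 'a::field vec set \<Rightarrow> nat \<Rightarrow> bool" where
  "subspace_of_dim t W d \<longleftrightarrow>
     VectorSpace.subspace class_ring W (module_vec TYPE('a) t) \<and>
     vectorspace.dim class_ring ((module_vec TYPE('a) t)\<lparr>carrier := W\<rparr>) = d"

text \<open>
  The argument \<open>ip\<close> is the inner product of the field. The intended values are
  \<open>x \<bullet>c y\<close>, the sum of \<open>x $ i * cnj (y $ i)\<close>, over the complex numbers, and
  \<open>x \<bullet> y\<close>, the sum of \<open>x $ i * y $ i\<close>, over every other field. A finite simple graph is a
  \<open>pair_graph\<close>, where each edge is represented by its two orientations.
\<close>

definition subspace_choosable ::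
  "('a::field vec \<Rightarrow> 'a vec \<Rightarrow> 'a) \<Rightarrow> 'v pair_pre_digraph \<Rightarrow> ('v \<Rightarrow> nat) \<Rightarrow> bool" where
  "subspace_choosable ip G f \<longleftrightarrow>
     (\<forall>t W. (\<forall>v\<in>pverts G. subspace_of_dim t (W v) (f v)) \<longrightarrow>
        (\<exists>x. (\<forall>v\<in>pverts G. x v \<in> W v \<and> x v \<noteq> 0\<^sub>v t) \<and>
             (\<forall>(u, v)\<in>parcs G. ip (x u) (x v) = 0)))"

definition complete_bipartite :: "'v set \<Rightarrow> 'v set \<Rightarrow> 'v pair_pre_digraph" where
  "complete_bipartite A B = \<lparr>pverts = A \<union> B, parcs = A \<times> B \<union> B \<times> A\<rparr>"

definition bipartite_subspace_choosable ::
  "('a::field vec \<Rightarrow> 'a vec \<Rightarrow> 'a) \<Rightarrow> 'v set \<Rightarrow> 'v set \<Rightarrow> nat \<Rightarrow> nat \<Rightarrow> bool" where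
  "bipartite_subspace_choosable ip A B k\<^sub>1 k\<^sub>2 \<longleftrightarrow>
     subspace_choosable ip (complete_bipartite A B) (\<lambda>v. if v \<in> A then k\<^sub>1 else k\<^sub>2)"

lemma complete_bipartite_is_K:
  assumes "finite A" "finite B" "A \<inter> B = {}"
  shows "complete_bipartite_digraph (card A) (card B) (with_proj (complete_bipartite A B))"
  unfolding complete_bipartite_digraph_pair_def complete_bipartite_def
  using assms by auto

lemma pair_graph_complete_bipartite:
  assumes "finite A" "finite B" "A \<inter> B = {}"
  shows "pair_graph (complete_bipartite A B)"
  using complete_bipartite_is_K[OF assms] by (rule pair_graphI_complete_bipartite)

lemma cscalar_prod_complex:
  fixes x y :: "complex vec"
  shows "x \<bullet>c y = (\<Sum>i<dim_vec y. x $ i * cnj (y $ i))"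
  by (simp add: scalar_prod_def lessThan_atLeast0)

end

theory Submission
  imports Defs
begin

text \<open>
  Write a vector of a left subspace in a basis, and likewise on the right. Every orthogonality
  condition then becomes the vanishing of a bilinear form in the coefficients, and only the matrix
  of the form for each edge matters. So the theorem is a statement about families of matrices over
  a field, \<open>bipartite_bilinear_zeros\<close>. A conjugation in the second argument of the
  inner product is absorbed by conjugating the coefficients on the right
  (\<open>bipartite_subspace_choosable_sesquilinear\<close>).

  The matrix statement is proved by induction on the number \<open>k\<close> of left vertices. Let \<open>q\<close> be
  \<open>(n - 1) div k\<close> and split off \<open>q\<close> right vertices. A left vertex \<open>a\<close> can be given a nonzero vector
  orthogonal to all of these \<open>q\<close> right spaces at once, because this imposes only \<open>q * k < n\<close> linear
  conditions. These right vertices are then indifferent to \<open>a\<close>: a nonzero vector of the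
  \<open>k\<close>-dimensional space has to satisfy only the \<open>k - 1\<close> conditions of the other left vertices, so
  it can be chosen last. Every other right space is cut down to a subspace of dimension \<open>k - 1\<close>
  that is orthogonal to the chosen vector. What remains is the same problem with \<open>k - 1\<close> left
  vertices and right spaces of dimension \<open>k - 1\<close>, so in total
  \<open>(n - 1) div k + (n - 1) div (k - 1) + \<dots> + (n - 1) div 1\<close> right vertices can be served.
\<close>

section \<open>Elimination of a variable\<close>

text \<open>
  The pivot step of Gaussian elimination. If \<open>\<phi>\<close> is not zero, the pivot \<open>p\<close> is a
  point with \<open>\<phi> p \<noteq> 0\<close>; if \<open>\<phi>\<close> is zero, every \<open>p\<close> serves, with \<open>r\<close> arbitrary.
\<close>

lemma exists_pivot:
  fixes \<phi> :: "'j \<Rightarrow> 'a::field"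
  assumes "J \<noteq> {}"
  obtains p r where "p \<in> J" "\<And>l. l \<in> J \<Longrightarrow> \<phi> l = \<phi> p * r l"
proof (cases "\<forall>j\<in>J. \<phi> j = 0")
  case True
  then show ?thesis using assms that[of _ "\<lambda>_. 0"] by auto
next
  case False
  then obtain p where p: "p \<in> J" "\<phi> p \<noteq> 0" by auto
  show ?thesis by (rule that[of p "\<lambda>l. \<phi> l / \<phi> p"]) (use p in auto)
qed

text \<open>
  The map \<open>y \<mapsto> y(p := - (\<Sum>l. r l * y l))\<close> embeds the functions on \<open>J - {p}\<close> into
  the functions on \<open>J\<close>. With \<open>p\<close> and \<open>r\<close> from \<open>exists_pivot\<close> its image is annihilated by
  \<open>\<phi>\<close>, as the case \<open>\<psi> = \<phi>\<close> shows, and every other linear form \<open>\<psi>\<close> pulls back to one with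
  the coefficients on the right-hand side.
\<close>

lemma sum_eliminate:
  fixes \<psi> y r :: "'j \<Rightarrow> 'a::field"
  assumes "finite J" "p \<in> J"
  shows "(\<Sum>l\<in>J. \<psi> l * (y(p := - (\<Sum>l\<in>J - {p}. r l * y l))) l)
       = (\<Sum>l\<in>J - {p}. (\<psi> l - \<psi> p * r l) * y l)"
proof -
  have "(\<Sum>l\<in>J. \<psi> l * (y(p := - (\<Sum>l\<in>J - {p}. r l * y l))) l)
      = - (\<psi> p * (\<Sum>l\<in>J - {p}. r l * y l)) + (\<Sum>l\<in>J - {p}. \<psi> l * y l)"
    using assms by (simp add: sum.remove)
  also have "\<dots> = (\<Sum>l\<in>J - {p}. (\<psi> l - \<psi> p * r l) * y l)"
    by (simp add: left_diff_distrib sum_subtractf sum_distrib_left mult.assoc)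
  finally show ?thesis .
qed

lemma underdetermined_system_has_nonzero_solution:
  fixes N :: "'e \<Rightarrow> 'j \<Rightarrow> 'a::field"
  assumes "finite E" "finite J" "card E < card J"
  shows "\<exists>y. (\<exists>j\<in>J. y j \<noteq> 0) \<and> (\<forall>e\<in>E. (\<Sum>j\<in>J. N e j * y j) = 0)"
  using assms
proof (induction E arbitrary: N J rule: finite_induct)
  case empty
  then have "J \<noteq> {}" by auto
  then show ?case by (intro exI[of _ "\<lambda>_. 1"]) auto
next
  case (insert e E)
  then have "J \<noteq> {}" by auto
  then obtain p r where p: "p \<in> J" and r: "\<And>l. l \<in> J \<Longrightarrow> N e l = N e p * r l"
    using exists_pivot[of J "N e"] by blast
  have "card E < card (J - {p})" using insert p by simp
  with insert.IH[of "J - {p}" "\<lambda>e l. N e l - N e p * r l"] insert.prems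
  obtain y where y: "\<exists>j\<in>J - {p}. y j \<noteq> 0"
    and E: "\<And>e. e \<in> E \<Longrightarrow> (\<Sum>l\<in>J - {p}. (N e l - N e p * r l) * y l) = 0"
    by auto
  let ?y = "y(p := - (\<Sum>l\<in>J - {p}. r l * y l))"
  have "(\<Sum>j\<in>J. N e' j * ?y j) = 0" if "e' \<in> insert e E" for e'
  proof (cases "e' = e")
    case True
    then show ?thesis
      unfolding sum_eliminate[OF \<open>finite J\<close> p] by (auto intro!: sum.neutral simp: r[symmetric])
  next
    case False
    with that E show ?thesis unfolding sum_eliminate[OF \<open>finite J\<close> p] by simp
  qed
  moreover have "\<exists>j\<in>J. ?y j \<noteq> 0" using y by auto
  ultimately show ?case by blast
qed

section \<open>Simultaneous zeros of bilinear forms\<close>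

text \<open>
  The coefficient form of the theorem. The index sets \<open>I a\<close> and \<open>J b\<close> stand for bases of the spaces
  at \<open>a\<close> and \<open>b\<close>. They are arbitrary finite sets, not initial segments of the natural numbers, so
  that the induction can pass from \<open>J b\<close> to \<open>J b - {p}\<close> without renumbering.
\<close>

lemma bipartite_bilinear_zeros:
  fixes M :: "'v \<Rightarrow> 'w \<Rightarrow> 'i \<Rightarrow> 'j \<Rightarrow> 'a::field"
  assumes "n \<ge> 1" "finite A" "finite B"
    and "card A = k" "card B = (\<Sum>j = 1..k. (n - 1) div j)"
    and "\<And>a. a \<in> A \<Longrightarrow> finite (I a) \<and> card (I a) = n"
    and "\<And>b. b \<in> B \<Longrightarrow> finite (J b) \<and> card (J b) = k"
  shows "\<exists>x y. (\<forall>a\<in>A. \<exists>i\<in>I a. x a i \<noteq> 0) \<and> (\<forall>b\<in>B. \<exists>j\<in>J b. y b j \<noteq> 0) \<and>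
           (\<forall>a\<in>A. \<forall>b\<in>B. (\<Sum>j\<in>J b. (\<Sum>i\<in>I a. x a i * M a b i j) * y b j) = 0)"
  using assms
proof (induction k arbitrary: A B J M)
  case 0
  then show ?case by auto
next
  case (Suc k)
  from Suc.prems obtain a where a: "a \<in> A" by fastforce
  define A' where "A' = A - {a}"
  have A': "finite A'" "card A' = k" "A = insert a A'"
    using Suc.prems a by (auto simp: A'_def)
  define q where "q = (n - 1) div Suc k"
  have "q \<le> card B" using Suc.prems by (simp add: q_def)
  then obtain B0 where B0: "B0 \<subseteq> B" "card B0 = q"
    by (meson obtain_subset_with_card_n)
  have finB0: "finite B0" using B0 Suc.prems finite_subset by blast
  have cardB: "card (B - B0) = (\<Sum>j = 1..k. (n - 1) div j)"
    using Suc.prems B0 by (simp add: card_Diff_subset finB0 q_def)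
  have J: "finite (J b)" "card (J b) = Suc k" if "b \<in> B" for b using Suc.prems that by auto
  have Ia: "finite (I a)" "card (I a) = n" using Suc.prems a by auto

  \<comment> \<open>A nonzero vector at \<open>a\<close> that is orthogonal to the whole spaces at the vertices of \<open>B0\<close>.\<close>
  have "card (Sigma B0 J) = q * Suc k"
    using B0 finB0 J by (subst card_SigmaI) (auto simp: subset_iff)
  also have "\<dots> \<le> n - 1" unfolding q_def by (rule div_times_less_eq_dividend)
  finally have "card (Sigma B0 J) < card (I a)" using Ia Suc.prems by simp
  moreover have "finite (Sigma B0 J)" using finB0 J B0 by auto
  ultimately obtain xa where xa: "\<exists>i\<in>I a. xa i \<noteq> 0"
    and "\<forall>e\<in>Sigma B0 J. (\<Sum>i\<in>I a. (case e of (b, j) \<Rightarrow> M a b i j) * xa i) = 0"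
    using underdetermined_system_has_nonzero_solution[of "Sigma B0 J" "I a"
        "\<lambda>e i. case e of (b, j) \<Rightarrow> M a b i j"] Ia
    by blast
  then have xa0: "(\<Sum>i\<in>I a. xa i * M a b i j) = 0" if "b \<in> B0" "j \<in> J b" for b j
    using that by (auto simp: mult.commute)

  \<comment> \<open>The other right spaces shrink by one dimension to become orthogonal to \<open>xa\<close>.\<close>
  define \<phi> where "\<phi> b j = (\<Sum>i\<in>I a. xa i * M a b i j)" for b j
  have "\<exists>p r. p \<in> J b \<and> (\<forall>l\<in>J b. \<phi> b l = \<phi> b p * r l)" if "b \<in> B" for b
  proof -
    have "J b \<noteq> {}" using J[OF that] by auto
    then show ?thesis by (metis exists_pivot[where \<phi> = "\<phi> b"])
  qed
  then obtain p r where p: "\<And>b. b \<in> B \<Longrightarrow> p b \<in> J b"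
    and r: "\<And>b l. b \<in> B \<Longrightarrow> l \<in> J b \<Longrightarrow> \<phi> b l = \<phi> b (p b) * r b l"
    by metis
  have "\<exists>x y. (\<forall>a\<in>A'. \<exists>i\<in>I a. x a i \<noteq> 0) \<and> (\<forall>b\<in>B - B0. \<exists>j\<in>J b - {p b}. y b j \<noteq> 0) \<and>
           (\<forall>a\<in>A'. \<forall>b\<in>B - B0. (\<Sum>j\<in>J b - {p b}.
              (\<Sum>i\<in>I a. x a i * (M a b i j - M a b i (p b) * r b j)) * y b j) = 0)"
    by (rule Suc.IH[where A = A' and B = "B - B0" and J = "\<lambda>b. J b - {p b}"
          and M = "\<lambda>a b i j. M a b i j - M a b i (p b) * r b j"])
      (use Suc.prems A' cardB J p in auto)
  then obtain x y where x: "\<forall>a\<in>A'. \<exists>i\<in>I a. x a i \<noteq> 0"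
    and y: "\<forall>b\<in>B - B0. \<exists>j\<in>J b - {p b}. y b j \<noteq> 0"
    and xy: "\<forall>a\<in>A'. \<forall>b\<in>B - B0. (\<Sum>j\<in>J b - {p b}.
              (\<Sum>i\<in>I a. x a i * (M a b i j - M a b i (p b) * r b j)) * y b j) = 0"
    by (elim exE conjE)
  define x' where "x' = x(a := xa)"

  have "\<exists>y. (\<exists>j\<in>J b. y j \<noteq> 0) \<and>
      (\<forall>a\<in>A. (\<Sum>j\<in>J b. (\<Sum>i\<in>I a. x' a i * M a b i j) * y j) = 0)" if b: "b \<in> B" for b
  proof (cases "b \<in> B0")
    case True
    \<comment> \<open>Here \<open>a\<close> imposes no condition, so there are only \<open>k\<close> equations in \<open>k + 1\<close> unknowns.\<close>
    have "card A' < card (J b)" using A' J b by simp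
    then obtain z where z: "\<exists>j\<in>J b. z j \<noteq> 0"
      and eq: "\<forall>a\<in>A'. (\<Sum>j\<in>J b. (\<Sum>i\<in>I a. x' a i * M a b i j) * z j) = 0"
      using underdetermined_system_has_nonzero_solution[of A' "J b"
          "\<lambda>a j. \<Sum>i\<in>I a. x' a i * M a b i j"] A' J b
      by blast
    have "(\<Sum>j\<in>J b. (\<Sum>i\<in>I a. x' a i * M a b i j) * z j) = 0"
      using xa0 True by (simp add: x'_def)
    then show ?thesis using z eq A' by auto
  next
    case False
    let ?z = "(y b)(p b := - (\<Sum>l\<in>J b - {p b}. r b l * y b l))"
    have elim: "(\<Sum>l\<in>J b. \<psi> l * ?z l) = (\<Sum>l\<in>J b - {p b}. (\<psi> l - \<psi> (p b) * r b l) * y b l)" for \<psi>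
      by (rule sum_eliminate[OF J(1)[OF b] p[OF b]])
    have "(\<Sum>j\<in>J b. (\<Sum>i\<in>I a'. x' a' i * M a' b i j) * ?z j) = 0" if a': "a' \<in> A" for a'
    proof (cases "a' = a")
      case True
      have "(\<Sum>j\<in>J b. \<phi> b j * ?z j) = 0"
        unfolding elim by (auto intro!: sum.neutral simp: r[OF b, symmetric])
      then show ?thesis by (simp add: True x'_def \<phi>_def)
    next
      case False
      then have "a' \<in> A'" using a' A' by simp
      with xy \<open>b \<notin> B0\<close> b
      have "(\<Sum>j\<in>J b - {p b}.
          (\<Sum>i\<in>I a'. x a' i * (M a' b i j - M a' b i (p b) * r b j)) * y b j) = 0" by blast
      with False show ?thesis
        unfolding elim
        by (simp add: x'_def right_diff_distrib sum_subtractf sum_distrib_right mult.assoc)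
    qed
    moreover have "\<exists>j\<in>J b. ?z j \<noteq> 0" using y b False by auto
    ultimately show ?thesis by blast
  qed
  then have "\<exists>y. \<forall>b\<in>B. (\<exists>j\<in>J b. y b j \<noteq> 0) \<and>
      (\<forall>a\<in>A. (\<Sum>j\<in>J b. (\<Sum>i\<in>I a. x' a i * M a b i j) * y b j) = 0)"
    by (intro bchoice ballI)
  then obtain y' where "\<forall>b\<in>B. (\<exists>j\<in>J b. y' b j \<noteq> 0) \<and>
      (\<forall>a\<in>A. (\<Sum>j\<in>J b. (\<Sum>i\<in>I a. x' a i * M a b i j) * y' b j) = 0)"
    by (elim exE)
  moreover have "\<exists>i\<in>I a'. x' a' i \<noteq> 0" if "a' \<in> A" for a'
    using that x xa A' by (auto simp: x'_def)
  ultimately show ?case by blast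
qed

section \<open>From subspaces to coefficients\<close>

text \<open>
  The set \<open>X\<close> is a basis of \<open>W\<close>, so that a nonzero coefficient function yields a nonzero vector
  of \<open>W\<close>. The dimension is defined as the least size of a finite generating set, and \<open>W\<close> is not
  given with one; the basis is therefore a maximal independent subset of \<open>W\<close>, which exists because
  the ambient dimension bounds the size of independent sets.
\<close>

lemma subspace_of_dim_independent_family:
  fixes W :: "'a::field vec set"
  assumes W: "subspace_of_dim t W d"
  obtains X where "finite X" "card X = d" "X \<subseteq> carrier_vec t"
    "\<And>c. module.lincomb (module_vec TYPE('a) t) c X \<in> W"
    "\<And>c. \<exists>v\<in>X. c v \<noteq> 0 \<Longrightarrow> module.lincomb (module_vec TYPE('a) t) c X \<noteq> 0\<^sub>v t"
proof -
  interpret V: vec_space "TYPE('a)" t .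
  let ?V = "module_vec TYPE('a) t"
  let ?W = "?V\<lparr>carrier := W\<rparr>"
  have sub: "submodule class_ring W ?V"
    and dim: "vectorspace.dim class_ring ?W = d"
    using W by (auto simp: subspace_of_dim_def subspace_def)
  interpret W: vectorspace class_ring ?W
    using W V.subspace_is_vs by (auto simp: subspace_of_dim_def)
  have WV: "W \<subseteq> carrier_vec t" using sub by (auto simp: submodule_def module_vec_simps)
  have li: "W.lin_dep X = V.lin_dep X" if "X \<subseteq> W" for X
    using V.span_li_not_depend(2)[OF that sub] by simp
  have bound: "finite X \<and> card X \<le> t" if "X \<subseteq> carrier ?W \<and> W.lin_indpt X" for X
    using that li V.li_le_dim[OF V.fin_dim, of X] WV V.dim_is_n by auto
  have "W.lin_indpt {}" unfolding W.lin_dep_def by auto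
  then obtain X where X: "finite X" "maximal X (\<lambda>S. S \<subseteq> carrier ?W \<and> W.lin_indpt S)"
    using maximal_exists[of "\<lambda>S. S \<subseteq> carrier ?W \<and> W.lin_indpt S" t "{}"] bound by auto
  then have basis: "W.basis X" by (auto intro: W.max_li_is_basis)
  then have XW: "X \<subseteq> W" and ind: "V.lin_indpt X" using li by (auto simp: W.basis_def)
  have card: "card X = d" using W.dim_basis[OF X(1) basis] dim by simp
  have closed: "V.lincomb c X \<in> W" for c
    using V.lincomb_not_depend[OF X(1) XW sub, of c] W.lincomb_closed[of X c] XW
    by (simp add: class_ring_simps)
  have nonzero: "V.lincomb c X \<noteq> 0\<^sub>v t" if "\<exists>v\<in>X. c v \<noteq> 0" for c
    using ind that X(1) unfolding V.lin_dep_def by (auto simp: class_ring_simps module_vec_simps)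
  show ?thesis
    by (rule that[OF X(1) card _ closed nonzero]) (use XW WV in auto)
qed

text \<open>
  The ordinary and the Hermitian inner product are both of the form \<open>x \<bullet> map_vec \<sigma> y\<close>, with \<open>\<sigma>\<close> the
  identity or the complex conjugation.
\<close>

lemma scalar_prod_map_vec_lincomb:
  fixes \<sigma> :: "'a::field \<Rightarrow> 'a"
  assumes add: "\<And>z w. \<sigma> (z + w) = \<sigma> z + \<sigma> w" and mult: "\<And>z w. \<sigma> (z * w) = \<sigma> z * \<sigma> w"
    and X: "X \<subseteq> carrier_vec t" and Y: "Y \<subseteq> carrier_vec t" "finite X" "finite Y"
  shows "module.lincomb (module_vec TYPE('a) t) c X
           \<bullet> map_vec \<sigma> (module.lincomb (module_vec TYPE('a) t) d Y)
       = (\<Sum>y\<in>Y. (\<Sum>x\<in>X. c x * (x \<bullet> map_vec \<sigma> y)) * \<sigma> (d y))"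
proof -
  interpret V: vec_space "TYPE('a)" t .
  have zero: "\<sigma> 0 = 0" by (metis add add.right_neutral add_left_cancel)
  have sum: "\<sigma> (sum f S) = (\<Sum>s\<in>S. \<sigma> (f s))" for f :: "'a vec \<Rightarrow> 'a" and S
    by (induction S rule: infinite_finite_induct) (auto simp: zero add)
  have dim: "dim_vec (V.lincomb d Y) = t" using Y by (intro V.lincomb_dim)
  have "V.lincomb c X \<bullet> map_vec \<sigma> (V.lincomb d Y)
      = (\<Sum>i = 0..<t. (\<Sum>x\<in>X. c x * x $ i) * (\<Sum>y\<in>Y. \<sigma> (d y) * \<sigma> (y $ i)))"
    unfolding scalar_prod_def index_map_vec(2) dim
    using X Y by (intro sum.cong refl) (simp add: dim V.lincomb_index sum mult)
  also have "\<dots> = (\<Sum>i = 0..<t. \<Sum>y\<in>Y. \<Sum>x\<in>X. c x * (x $ i * \<sigma> (y $ i)) * \<sigma> (d y))"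
    unfolding sum_product by (subst sum.swap[of _ Y X]) (simp add: mult_ac)
  also have "\<dots> = (\<Sum>y\<in>Y. \<Sum>x\<in>X. \<Sum>i = 0..<t. c x * (x $ i * \<sigma> (y $ i)) * \<sigma> (d y))"
    by (subst sum.swap, intro sum.cong refl, rule sum.swap)
  also have "\<dots> = (\<Sum>y\<in>Y. (\<Sum>x\<in>X. c x * (\<Sum>i = 0..<t. x $ i * \<sigma> (y $ i))) * \<sigma> (d y))"
    by (simp add: sum_distrib_left sum_distrib_right)
  also have "\<dots> = (\<Sum>y\<in>Y. (\<Sum>x\<in>X. c x * (x \<bullet> map_vec \<sigma> y)) * \<sigma> (d y))"
    using Y by (intro sum.cong refl arg_cong2[where f = "(*)"]) (auto simp: scalar_prod_def)
  finally show ?thesis .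
qed

text \<open>
  Since \<open>\<sigma>\<close> is an involution, coefficients \<open>y\<close> that solve the bilinear problem come from the
  vector with the coefficients \<open>\<sigma> \<circ> y\<close>, and orthogonality is symmetric, so that both
  orientations of an edge give the same condition.
\<close>

lemma bipartite_subspace_choosable_sesquilinear:
  fixes \<sigma> :: "'a::field \<Rightarrow> 'a" and A B :: "'v set"
  assumes add: "\<And>z w. \<sigma> (z + w) = \<sigma> z + \<sigma> w" and mult: "\<And>z w. \<sigma> (z * w) = \<sigma> z * \<sigma> w"
    and inv: "\<And>z. \<sigma> (\<sigma> z) = z"
    and AB: "n \<ge> 1" "finite A" "finite B" "A \<inter> B = {}"
    and card: "card A = k" "card B = (\<Sum>j = 1..k. (n - 1) div j)"
  shows "bipartite_subspace_choosable (\<lambda>x y. x \<bullet> map_vec \<sigma> y) A B n k"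
  unfolding bipartite_subspace_choosable_def subspace_choosable_def complete_bipartite_def
proof (simp only: pair_pre_digraph.simps, intro allI impI)
  fix t and W :: "'v \<Rightarrow> 'a vec set"
  assume W: "\<forall>v\<in>A \<union> B. subspace_of_dim t (W v) (if v \<in> A then n else k)"
  interpret V: vec_space "TYPE('a)" t .
  have "\<exists>X. finite X \<and> card X = (if v \<in> A then n else k) \<and> X \<subseteq> carrier_vec t \<and>
      (\<forall>c. V.lincomb c X \<in> W v) \<and> (\<forall>c. (\<exists>u\<in>X. c u \<noteq> 0) \<longrightarrow> V.lincomb c X \<noteq> 0\<^sub>v t)"
    if "v \<in> A \<union> B" for v
    using subspace_of_dim_independent_family[OF bspec[OF W that]] by metis
  then obtain X where X: "\<And>v. v \<in> A \<union> B \<Longrightarrow> finite (X v) \<and>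
      card (X v) = (if v \<in> A then n else k) \<and> X v \<subseteq> carrier_vec t \<and>
      (\<forall>c. V.lincomb c (X v) \<in> W v) \<and>
      (\<forall>c. (\<exists>u\<in>X v. c u \<noteq> 0) \<longrightarrow> V.lincomb c (X v) \<noteq> 0\<^sub>v t)"
    by metis
  have "\<exists>x y. (\<forall>a\<in>A. \<exists>i\<in>X a. x a i \<noteq> 0) \<and> (\<forall>b\<in>B. \<exists>j\<in>X b. y b j \<noteq> 0) \<and>
      (\<forall>a\<in>A. \<forall>b\<in>B. (\<Sum>j\<in>X b. (\<Sum>i\<in>X a. x a i * (i \<bullet> map_vec \<sigma> j)) * y b j) = 0)"
    by (rule bipartite_bilinear_zeros[where M = "\<lambda>_ _ i j. i \<bullet> map_vec \<sigma> j" and n = n and k = k])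
      (use AB card X in auto)
  then obtain x y where x: "\<forall>a\<in>A. \<exists>i\<in>X a. x a i \<noteq> 0"
    and y: "\<forall>b\<in>B. \<exists>j\<in>X b. y b j \<noteq> 0"
    and xy: "\<forall>a\<in>A. \<forall>b\<in>B.
      (\<Sum>j\<in>X b. (\<Sum>i\<in>X a. x a i * (i \<bullet> map_vec \<sigma> j)) * y b j) = 0"
    by (elim exE conjE)
  have zero: "\<sigma> 0 = 0" by (metis add add.right_neutral add_left_cancel)
  have nonzero: "\<sigma> z \<noteq> 0" if "z \<noteq> 0" for z using inv[of z] that zero by metis
  have sum: "\<sigma> (sum f S) = (\<Sum>s\<in>S. \<sigma> (f s))" for f :: "nat \<Rightarrow> 'a" and S
    by (induction S rule: infinite_finite_induct) (auto simp: zero add)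
  define g where "g v = V.lincomb (if v \<in> A then x v else \<sigma> \<circ> y v) (X v)" for v
  have g: "g v \<in> W v \<and> g v \<noteq> 0\<^sub>v t" if "v \<in> A \<union> B" for v
    using X[OF that] x y nonzero that by (auto simp: g_def) (metis comp_apply)
  have dim: "dim_vec (g v) = t" if "v \<in> A \<union> B" for v
    using X[OF that] unfolding g_def by (intro V.lincomb_dim) auto
  have left: "g a \<bullet> map_vec \<sigma> (g b) = 0" if "a \<in> A" "b \<in> B" for a b
  proof -
    have "b \<notin> A" using that AB by auto
    with that xy X[of a] X[of b] show ?thesis
      by (simp add: g_def scalar_prod_map_vec_lincomb[OF add mult] inv)
  qed
  have right: "g b \<bullet> map_vec \<sigma> (g a) = 0" if "a \<in> A" "b \<in> B" for a b
  proof -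
    have "g b \<bullet> map_vec \<sigma> (g a) = \<sigma> (g a \<bullet> map_vec \<sigma> (g b))"
      using dim that by (simp add: scalar_prod_def sum mult inv mult.commute)
    then show ?thesis using left[OF that] zero by simp
  qed
  show "\<exists>x. (\<forall>v\<in>A \<union> B. x v \<in> W v \<and> x v \<noteq> 0\<^sub>v t) \<and>
      (\<forall>(u, v)\<in>A \<times> B \<union> B \<times> A. x u \<bullet> map_vec \<sigma> (x v) = 0)"
    using g left right by (intro exI[of _ g]) auto
qed

theorem theorem5p4:
  fixes k n :: nat and A B :: "'v set"
  assumes "k \<ge> 1" and "n \<ge> 1"
    and "finite A" and "finite B" and "A \<inter> B = {}"
    and "card A = k"
    and "card B = (\<Sum>i = 0..k - 1. (n - 1) div (k - i))"
  shows "bipartite_subspace_choosable ((\<bullet>) :: 'a::field vec \<Rightarrow> 'a vec \<Rightarrow> 'a) A B n k \<and>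
         bipartite_subspace_choosable ((\<bullet>c) :: complex vec \<Rightarrow> complex vec \<Rightarrow> complex) A B n k"
proof -
  have "(\<Sum>i = 0..k - 1. (n - 1) div (k - i)) = (\<Sum>j = 1..k. (n - 1) div j)"
    using assms(1) by (intro sum.reindex_bij_witness[of _ "\<lambda>j. k - j" "\<lambda>i. k - i"]) auto
  with assms have card: "card B = (\<Sum>j = 1..k. (n - 1) div j)" by simp
  have "(\<lambda>x y :: 'a vec. x \<bullet> map_vec (\<lambda>z. z) y) = (\<bullet>)"
    by (intro ext) (simp add: scalar_prod_def)
  moreover have "bipartite_subspace_choosable (\<lambda>x y :: 'a vec. x \<bullet> map_vec (\<lambda>z. z) y) A B n k"
    using assms card by (intro bipartite_subspace_choosable_sesquilinear) auto
  moreover have "(\<lambda>x y :: complex vec. x \<bullet> map_vec cnj y) = (\<bullet>c)"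
    by (intro ext) (simp add: scalar_prod_def)
  moreover have "bipartite_subspace_choosable (\<lambda>x y :: complex vec. x \<bullet> map_vec cnj y) A B n k"
    using assms card by (intro bipartite_subspace_choosable_sesquilinear) auto
  ultimately show ?thesis by simp
qed

end
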